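(* Let $L,H$ be causal models in a Markov category $\mathcal C$ with sets of interventions $\mathcal I_L$ on $L$ and $\mathcal I_H$ on $H$. An exact transformation $(\tau,\omega)$ from $L$ to $H$ with intervention sets $\mathcal I_L,\mathcal I_H$ is equivalent to an upward abstraction $(\pi,\tau,\omega)\colon(\mathcal I_L^{\mathsf{io}},L)\to(\mathcal I_H^{\mathsf{io}},H)$.
   Context: **Categories.** A Markov category is a symmetric monoidal category with terminal unit $I$ in which each object has a commutative comonoid structure (copy, discard) compatible with $\otimes$. Morphisms are called channels; $f$ is deterministic if $\mathrm{copy}\circ f=(f\otimes f)\circ\mathrm{copy}$. **Causal models and interventions.** An open DAG is a finite DAG with vertex set $V$ and a subset $V^{\rm in}\subseteq V$ of parentless vertices (inputs); $V^{\rm nin}=V\setminus V^{\rm in}$. A causal model $M$ over it in $\mathcal C$ consists of an object of $\mathcal C$ (again written $X$) for each vertex $X$, a channel (mechanism) $c_X\colon\bigotimes_{Y\in\mathrm{Pa}(X)}Y\to X$ for each $X\in V^{\rm nin}$, and a subset $V^{\rm out}\subseteq V$ of outputs. A set of variables also denotes the tensor of the corresponding objects. $M^{\mathrm{io}}\colon V^{\rm in}\to V^{\rm out}$ is the channel obtained by wiring together, with copy maps, the mechanisms of all non-input variables having a directed path to $V^{\rm out}$, copying each output variable once more to form an output, and discarding inputs with no path to $V^{\rm out}$. An intervention $\sigma$ on $M$ specifies new mechanisms $c'_X$ (possibly with new parents, but introducing no directed cycles) for a subset of variables $X\in V^{\rm nin}$, yielding a new causal model $M_\sigma$ with the same variables,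 objects, inputs and outputs. **Exact transformation** from $L$ to $H$ with intervention sets $\mathcal I_L,\mathcal I_H$: a pair of epic deterministic channels $V_L^{\rm in}\to V_H^{\rm in}$ and $V_L^{\rm out}\to V_H^{\rm out}$, both written $\tau$ (or $\tau^{\rm in},\tau^{\rm out}$ to distinguish them), and a surjective partial function $\omega$ from $\mathcal I_L$ to $\mathcal I_H$, such that whenever $\omega$ is defined on $\sigma\in\mathcal I_L$, $\tau^{\rm out}\circ L_\sigma^{\mathrm{io}}=H_{\omega(\sigma)}^{\mathrm{io}}\circ\tau^{\rm in}$. **Query signatures and upward abstractions.** A query signature $Q$ is a set of types and a set of queries, each with finite lists of input and output types; a model of $Q$ in $\mathcal C$ assigns to each type an object and to each query a channel of the corresponding type, denoted $[\![-]\!]$. For a set $\mathcal I$ of interventions on $M$, the query signature $\mathcal I^{\mathsf{io}}$ has exactly two types $\mathsf{in},\mathsf{out}$ and a query $\sigma\colon\mathsf{in}\to\mathsf{out}$ for each $\sigma\in\mathcal I$, modelled by $[\![\mathsf{in}]\!]=V^{\rm in}$, $[\![\mathsf{out}]\!]=V^{\rm out}$, $[\![\sigma]\!]=M_\sigma^{\mathrm{io}}$. Write $\mathsf{in}_L,\mathsf{out}_L$ and $\mathsf{in}_H,\mathsf{out}_H$ for the types of $\mathcal I_L^{\mathsf{io}}$ and $\mathcal I_H^{\mathsf{io}}$. An upward abstraction $(\pi,\tau,\omega)\colon(Q_L,L)\to(Q_H,H)$ consists of: for each type $X$ of $Q_H$, a list $\pi(X)$ of types of $Q_L$ and an epic deterministic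 channel $\tau_X\colon[\![\pi(X)]\!]_L\to[\![X]\!]_H$ (extended to lists by concatenation and tensor product, all such products being required to be epic); and a partial surjective map $\omega$ from queries of $Q_L$ to queries of $Q_H$ such that whenever $\omega(q_L)=q_H\colon X\to Y$ is defined, $q_L$ has type $\pi(X)\to\pi(Y)$ and $\tau_Y\circ[\![q_L]\!]_L=[\![q_H]\!]_H\circ\tau_X$. In the claim, the map on types is $\pi(\mathsf{in}_H)=\mathsf{in}_L$, $\pi(\mathsf{out}_H)=\mathsf{out}_L$, with $\tau_{\mathsf{in}_H}=\tau^{\rm in}$, $\tau_{\mathsf{out}_H}=\tau^{\rm out}$.
   Formalization: Products of τ are required epic only for lists occurring in queries; if required for all lists of types, the equivalence fails in general (epics need not be closed under tensor), and it is then stated with the added condition that all these products are epic. *)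

theory Defs
  imports Main
begin

section \<open>Markov categories\<close>

text \<open>Composition is in applicative order: \<open>g \<cdot> f\<close> is \<open>g\<close> after \<open>f\<close>. The monoidal structure is
  not assumed to be strict.\<close>

record ('o, 'm) markov_data =
  Obj :: "'o set"
  Arr :: "'m set"
  Dom :: "'m \<Rightarrow> 'o"
  Cod :: "'m \<Rightarrow> 'o"
  Ident :: "'o \<Rightarrow> 'm"
  Comp :: "'m \<Rightarrow> 'm \<Rightarrow> 'm"  (infixr "\<cdot>\<index>" 60)
  Tensor_obj :: "'o \<Rightarrow> 'o \<Rightarrow> 'o"  (infixr "\<odot>\<index>" 70)
  Tensor :: "'m \<Rightarrow> 'm \<Rightarrow> 'm"  (infixr "\<otimes>\<index>" 70)
  Unit_obj :: 'o
  Assoc :: "'o \<Rightarrow> 'o \<Rightarrow> 'o \<Rightarrow> 'm"  \<comment> \<open>\<open>(A \<odot> B) \<odot> D \<rightarrow> A \<odot> (B \<odot> D)\<close>\<close>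
  Lunit :: "'o \<Rightarrow> 'm"
  Runit :: "'o \<Rightarrow> 'm"
  Braid :: "'o \<Rightarrow> 'o \<Rightarrow> 'm"
  Copy :: "'o \<Rightarrow> 'm"
  Discard :: "'o \<Rightarrow> 'm"

definition Hom :: "('o, 'm, 'z) markov_data_scheme \<Rightarrow> 'o \<Rightarrow> 'o \<Rightarrow> 'm set" where
  "Hom C A B = {f \<in> Arr C. Dom C f = A \<and> Cod C f = B}"

definition is_inverse :: "('o, 'm, 'z) markov_data_scheme \<Rightarrow> 'm \<Rightarrow> 'm \<Rightarrow> bool" where
  "is_inverse C f g \<longleftrightarrow>
     g \<in> Hom C (Cod C f) (Dom C f) \<and>
     g \<cdot>\<^bsub>C\<^esub> f = Ident C (Dom C f) \<and> f \<cdot>\<^bsub>C\<^esub> g = Ident C (Cod C f)"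

definition is_iso :: "('o, 'm, 'z) markov_data_scheme \<Rightarrow> 'm \<Rightarrow> bool" where
  "is_iso C f \<longleftrightarrow> f \<in> Arr C \<and> (\<exists>g. is_inverse C f g)"

definition Inverse :: "('o, 'm, 'z) markov_data_scheme \<Rightarrow> 'm \<Rightarrow> 'm" where
  "Inverse C f = (THE g. is_inverse C f g)"

definition epic :: "('o, 'm, 'z) markov_data_scheme \<Rightarrow> 'm \<Rightarrow> bool" where
  "epic C f \<longleftrightarrow> f \<in> Arr C \<and>
     (\<forall>D g h. g \<in> Hom C (Cod C f) D \<longrightarrow> h \<in> Hom C (Cod C f) D \<longrightarrow>
        g \<cdot>\<^bsub>C\<^esub> f = h \<cdot>\<^bsub>C\<^esub> f \<longrightarrow> g = h)"

definition deterministic :: "('o, 'm, 'z) markov_data_scheme \<Rightarrow> 'm \<Rightarrow> bool" where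
  "deterministic C f \<longleftrightarrow>
     f \<in> Arr C \<and> Copy C (Cod C f) \<cdot>\<^bsub>C\<^esub> f = (f \<otimes>\<^bsub>C\<^esub> f) \<cdot>\<^bsub>C\<^esub> Copy C (Dom C f)"

locale category =
  fixes C :: "('o, 'm, 'z) markov_data_scheme" (structure)
  assumes dom_obj: "f \<in> Arr C \<Longrightarrow> Dom C f \<in> Obj C"
    and cod_obj: "f \<in> Arr C \<Longrightarrow> Cod C f \<in> Obj C"
    and ident_hom: "A \<in> Obj C \<Longrightarrow> Ident C A \<in> Hom C A A"
    and comp_hom: "\<lbrakk>f \<in> Hom C A B; g \<in> Hom C B D\<rbrakk> \<Longrightarrow> g \<cdot> f \<in> Hom C A D"
    and comp_ident_right: "f \<in> Hom C A B \<Longrightarrow> f \<cdot> Ident C A = f"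
    and comp_ident_left: "f \<in> Hom C A B \<Longrightarrow> Ident C B \<cdot> f = f"
    and comp_assoc: "\<lbrakk>f \<in> Hom C A B; g \<in> Hom C B D; h \<in> Hom C D E\<rbrakk> \<Longrightarrow> (h \<cdot> g) \<cdot> f = h \<cdot> (g \<cdot> f)"

locale monoidal_category = category +
  assumes unit_obj: "Unit_obj C \<in> Obj C"
    and tensor_obj: "\<lbrakk>A \<in> Obj C; B \<in> Obj C\<rbrakk> \<Longrightarrow> A \<odot> B \<in> Obj C"
    and tensor_hom: "\<lbrakk>f \<in> Hom C A B; g \<in> Hom C A' B'\<rbrakk> \<Longrightarrow> f \<otimes> g \<in> Hom C (A \<odot> A') (B \<odot> B')"
    and tensor_ident: "\<lbrakk>A \<in> Obj C; B \<in> Obj C\<rbrakk> \<Longrightarrow> Ident C A \<otimes> Ident C B = Ident C (A \<odot> B)"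
    and tensor_comp: "\<lbrakk>f \<in> Hom C A B; g \<in> Hom C B D; f' \<in> Hom C A' B'; g' \<in> Hom C B' D'\<rbrakk>
      \<Longrightarrow> (g \<cdot> f) \<otimes> (g' \<cdot> f') = (g \<otimes> g') \<cdot> (f \<otimes> f')"
    and assoc_hom: "\<lbrakk>A \<in> Obj C; B \<in> Obj C; D \<in> Obj C\<rbrakk>
      \<Longrightarrow> Assoc C A B D \<in> Hom C ((A \<odot> B) \<odot> D) (A \<odot> (B \<odot> D))"
    and assoc_iso: "\<lbrakk>A \<in> Obj C; B \<in> Obj C; D \<in> Obj C\<rbrakk> \<Longrightarrow> is_iso C (Assoc C A B D)"
    and assoc_natural: "\<lbrakk>f \<in> Hom C A A'; g \<in> Hom C B B'; h \<in> Hom C D D'\<rbrakk>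
      \<Longrightarrow> Assoc C A' B' D' \<cdot> ((f \<otimes> g) \<otimes> h) = (f \<otimes> (g \<otimes> h)) \<cdot> Assoc C A B D"
    and lunit_hom: "A \<in> Obj C \<Longrightarrow> Lunit C A \<in> Hom C (Unit_obj C \<odot> A) A"
    and lunit_iso: "A \<in> Obj C \<Longrightarrow> is_iso C (Lunit C A)"
    and lunit_natural: "f \<in> Hom C A B
      \<Longrightarrow> Lunit C B \<cdot> (Ident C (Unit_obj C) \<otimes> f) = f \<cdot> Lunit C A"
    and runit_hom: "A \<in> Obj C \<Longrightarrow> Runit C A \<in> Hom C (A \<odot> Unit_obj C) A"
    and runit_iso: "A \<in> Obj C \<Longrightarrow> is_iso C (Runit C A)"
    and runit_natural: "f \<in> Hom C A B
      \<Longrightarrow> Runit C B \<cdot> (f \<otimes> Ident C (Unit_obj C)) = f \<cdot> Runit C A"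
    and pentagon: "\<lbrakk>A \<in> Obj C; B \<in> Obj C; D \<in> Obj C; E \<in> Obj C\<rbrakk>
      \<Longrightarrow> Assoc C A B (D \<odot> E) \<cdot> Assoc C (A \<odot> B) D E =
          (Ident C A \<otimes> Assoc C B D E) \<cdot> Assoc C A (B \<odot> D) E \<cdot> (Assoc C A B D \<otimes> Ident C E)"
    and triangle: "\<lbrakk>A \<in> Obj C; B \<in> Obj C\<rbrakk>
      \<Longrightarrow> (Ident C A \<otimes> Lunit C B) \<cdot> Assoc C A (Unit_obj C) B = Runit C A \<otimes> Ident C B"

locale symmetric_monoidal_category = monoidal_category +
  assumes braid_hom: "\<lbrakk>A \<in> Obj C; B \<in> Obj C\<rbrakk> \<Longrightarrow> Braid C A B \<in> Hom C (A \<odot> B) (B \<odot> A)"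
    and braid_natural: "\<lbrakk>f \<in> Hom C A A'; g \<in> Hom C B B'\<rbrakk>
      \<Longrightarrow> Braid C A' B' \<cdot> (f \<otimes> g) = (g \<otimes> f) \<cdot> Braid C A B"
    and braid_braid: "\<lbrakk>A \<in> Obj C; B \<in> Obj C\<rbrakk> \<Longrightarrow> Braid C B A \<cdot> Braid C A B = Ident C (A \<odot> B)"
    and hexagon: "\<lbrakk>A \<in> Obj C; B \<in> Obj C; D \<in> Obj C\<rbrakk>
      \<Longrightarrow> Assoc C B D A \<cdot> Braid C A (B \<odot> D) \<cdot> Assoc C A B D =
          (Ident C B \<otimes> Braid C A D) \<cdot> Assoc C B A D \<cdot> (Braid C A B \<otimes> Ident C D)"

text \<open>The canonical map \<open>(A \<odot> A) \<odot> (B \<odot> B) \<rightarrow> (A \<odot> B) \<odot> (A \<odot> B)\<close> that exchanges the two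
  middle factors.\<close>

definition Middle_swap :: "('o, 'm, 'z) markov_data_scheme \<Rightarrow> 'o \<Rightarrow> 'o \<Rightarrow> 'm" where
  "Middle_swap C A B =
     Inverse C (Assoc C A B (A \<odot>\<^bsub>C\<^esub> B))
     \<cdot>\<^bsub>C\<^esub> (Ident C A \<otimes>\<^bsub>C\<^esub> Assoc C B A B)
     \<cdot>\<^bsub>C\<^esub> (Ident C A \<otimes>\<^bsub>C\<^esub> (Braid C A B \<otimes>\<^bsub>C\<^esub> Ident C B))
     \<cdot>\<^bsub>C\<^esub> (Ident C A \<otimes>\<^bsub>C\<^esub> Inverse C (Assoc C A B B))
     \<cdot>\<^bsub>C\<^esub> Assoc C A A (B \<odot>\<^bsub>C\<^esub> B)"

text \<open>Counitality on the right follows from counitality on the left and commutativity.\<close>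

locale markov_category = symmetric_monoidal_category +
  assumes unit_terminal: "A \<in> Obj C \<Longrightarrow> \<exists>!f. f \<in> Hom C A (Unit_obj C)"
    and copy_hom: "A \<in> Obj C \<Longrightarrow> Copy C A \<in> Hom C A (A \<odot> A)"
    and discard_hom: "A \<in> Obj C \<Longrightarrow> Discard C A \<in> Hom C A (Unit_obj C)"
    and copy_coassoc: "A \<in> Obj C
      \<Longrightarrow> Assoc C A A A \<cdot> (Copy C A \<otimes> Ident C A) \<cdot> Copy C A = (Ident C A \<otimes> Copy C A) \<cdot> Copy C A"
    and copy_counit: "A \<in> Obj C
      \<Longrightarrow> Lunit C A \<cdot> (Discard C A \<otimes> Ident C A) \<cdot> Copy C A = Ident C A"
    and copy_commute: "A \<in> Obj C \<Longrightarrow> Braid C A A \<cdot> Copy C A = Copy C A"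
    and copy_tensor: "\<lbrakk>A \<in> Obj C; B \<in> Obj C\<rbrakk>
      \<Longrightarrow> Copy C (A \<odot> B) = Middle_swap C A B \<cdot> (Copy C A \<otimes> Copy C B)"
    and discard_tensor: "\<lbrakk>A \<in> Obj C; B \<in> Obj C\<rbrakk>
      \<Longrightarrow> Discard C (A \<odot> B) = Lunit C (Unit_obj C) \<cdot> (Discard C A \<otimes> Discard C B)"


section \<open>Tensor products of lists of objects\<close>

text \<open>Bracketed to the right, with the unit object appearing only for the empty list; so the
  product of a one-element list is that element itself.\<close>

fun Tensor_list :: "('o, 'm, 'z) markov_data_scheme \<Rightarrow> 'o list \<Rightarrow> 'o" where
  "Tensor_list C [] = Unit_obj C"
| "Tensor_list C [A] = A"
| "Tensor_list C (A # B # As) = A \<odot>\<^bsub>C\<^esub> Tensor_list C (B # As)"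

text \<open>The coherence isomorphism from the product of \<open>As @ Bs\<close> to the product of \<open>As\<close> tensored
  with the product of \<open>Bs\<close>.\<close>

fun Split_list :: "('o, 'm, 'z) markov_data_scheme \<Rightarrow> 'o list \<Rightarrow> 'o list \<Rightarrow> 'm" where
  "Split_list C [] Bs = Inverse C (Lunit C (Tensor_list C Bs))"
| "Split_list C [A] [] = Inverse C (Runit C A)"
| "Split_list C [A] (B # Bs) = Ident C (A \<odot>\<^bsub>C\<^esub> Tensor_list C (B # Bs))"
| "Split_list C (A # A' # As) Bs =
     Inverse C (Assoc C A (Tensor_list C (A' # As)) (Tensor_list C Bs))
     \<cdot>\<^bsub>C\<^esub> (Ident C A \<otimes>\<^bsub>C\<^esub> Split_list C (A' # As) Bs)"


section \<open>Causal models and interventions\<close>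

text \<open>A linear order on the vertices serves to fix the order of the factors when the objects of a
  set of variables are tensored together. The value of \<open>mech\<close> is irrelevant on inputs.\<close>

record ('v, 'o, 'm) causal_model =
  verts :: "'v set"
  edges :: "('v \<times> 'v) set"
  inputs :: "'v set"
  outputs :: "'v set"
  object :: "'v \<Rightarrow> 'o"
  mech :: "'v \<Rightarrow> 'm"

definition parents :: "('v, 'o, 'm, 'y) causal_model_scheme \<Rightarrow> 'v \<Rightarrow> 'v set" where
  "parents M X = {Y. (Y, X) \<in> edges M}"

definition noninputs :: "('v, 'o, 'm, 'y) causal_model_scheme \<Rightarrow> 'v set" where
  "noninputs M = verts M - inputs M"

definition open_dag :: "('v, 'o, 'm, 'y) causal_model_scheme \<Rightarrow> bool" where
  "open_dag M \<longleftrightarrow>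
     finite (verts M) \<and> edges M \<subseteq> verts M \<times> verts M \<and> acyclic (edges M) \<and>
     inputs M \<subseteq> verts M \<and> (\<forall>X \<in> inputs M. parents M X = {})"

definition tensor_vars ::
  "('o, 'm, 'z) markov_data_scheme \<Rightarrow> ('v, 'o, 'm, 'y) causal_model_scheme \<Rightarrow> 'v list \<Rightarrow> 'o" where
  "tensor_vars C M Xs = Tensor_list C (map (object M) Xs)"

definition set_object ::
  "('o, 'm, 'z) markov_data_scheme \<Rightarrow> ('v::linorder, 'o, 'm, 'y) causal_model_scheme \<Rightarrow> 'v set \<Rightarrow> 'o"
where
  "set_object C M S = tensor_vars C M (sorted_list_of_set S)"

definition is_causal_model ::
  "('o, 'm, 'z) markov_data_scheme \<Rightarrow> ('v::linorder, 'o, 'm, 'y) causal_model_scheme \<Rightarrow> bool" where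
  "is_causal_model C M \<longleftrightarrow>
     open_dag M \<and> outputs M \<subseteq> verts M \<and>
     (\<forall>X \<in> verts M. object M X \<in> Obj C) \<and>
     (\<forall>X \<in> noninputs M. mech M X \<in> Hom C (set_object C M (parents M X)) (object M X))"

text \<open>An intervention maps each variable it acts on to its new parents and new mechanism.\<close>

type_synonym ('v, 'm) intervention = "'v \<rightharpoonup> 'v set \<times> 'm"

definition intervene ::
  "('v, 'o, 'm, 'y) causal_model_scheme \<Rightarrow> ('v, 'm) intervention \<Rightarrow>
   ('v, 'o, 'm, 'y) causal_model_scheme" where
  "intervene M \<sigma> = M \<lparr>
     edges := {(Y, X). case \<sigma> X of None \<Rightarrow> (Y, X) \<in> edges M | Some (P, c) \<Rightarrow> Y \<in> P},
     mech := (\<lambda>X. case \<sigma> X of None \<Rightarrow> mech M X | Some (P, c) \<Rightarrow> c) \<rparr>"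

definition is_intervention ::
  "('o, 'm, 'z) markov_data_scheme \<Rightarrow> ('v::linorder, 'o, 'm, 'y) causal_model_scheme \<Rightarrow>
   ('v, 'm) intervention \<Rightarrow> bool" where
  "is_intervention C M \<sigma> \<longleftrightarrow>
     dom \<sigma> \<subseteq> noninputs M \<and>
     (\<forall>X P c. \<sigma> X = Some (P, c) \<longrightarrow>
        P \<subseteq> verts M \<and> c \<in> Hom C (set_object C M P) (object M X)) \<and>
     acyclic (edges (intervene M \<sigma>))"


section \<open>The input-output channel of a causal model\<close>

text \<open>The string diagram is evaluated with a context, a list \<open>\<Gamma>\<close> of variables that are currently
  available, represented by the product of their objects. The map \<open>wire \<Gamma> \<Delta>\<close> is made of copy and
  discard maps only and produces one copy of each variable of \<open>\<Delta>\<close>, discarding the variables that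
  do not occur in \<open>\<Delta>\<close>. Superfluous copies are discarded later on; by the comonoid laws and
  terminality of the unit this does not change the resulting channel.\<close>

fun lookup ::
  "('o, 'm, 'z) markov_data_scheme \<Rightarrow> ('v, 'o, 'm, 'y) causal_model_scheme \<Rightarrow> 'v list \<Rightarrow> 'v \<Rightarrow> 'm"
where
  "lookup C M [] X = undefined"
| "lookup C M [Y] X = (if X = Y then Ident C (object M Y) else undefined)"
| "lookup C M (Y # Z # \<Gamma>) X =
     (if X = Y
      then Runit C (object M Y)
           \<cdot>\<^bsub>C\<^esub> (Ident C (object M Y) \<otimes>\<^bsub>C\<^esub> Discard C (tensor_vars C M (Z # \<Gamma>)))
      else Lunit C (object M X)
           \<cdot>\<^bsub>C\<^esub> (Discard C (object M Y) \<otimes>\<^bsub>C\<^esub> lookup C M (Z # \<Gamma>) X))"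

fun wire ::
  "('o, 'm, 'z) markov_data_scheme \<Rightarrow> ('v, 'o, 'm, 'y) causal_model_scheme \<Rightarrow>
   'v list \<Rightarrow> 'v list \<Rightarrow> 'm" where
  "wire C M \<Gamma> [] = Discard C (tensor_vars C M \<Gamma>)"
| "wire C M \<Gamma> [X] = lookup C M \<Gamma> X"
| "wire C M \<Gamma> (X # Y # \<Delta>) =
     (lookup C M \<Gamma> X \<otimes>\<^bsub>C\<^esub> wire C M \<Gamma> (Y # \<Delta>)) \<cdot>\<^bsub>C\<^esub> Copy C (tensor_vars C M \<Gamma>)"

text \<open>Apply the mechanism of \<open>X\<close>, from the context \<open>\<Gamma>\<close> to the context \<open>X # \<Gamma>\<close>.\<close>

definition apply_mech ::
  "('o, 'm, 'z) markov_data_scheme \<Rightarrow> ('v::linorder, 'o, 'm, 'y) causal_model_scheme \<Rightarrow>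
   'v list \<Rightarrow> 'v \<Rightarrow> 'm" where
  "apply_mech C M \<Gamma> X =
     (let c = mech M X \<cdot>\<^bsub>C\<^esub> wire C M \<Gamma> (sorted_list_of_set (parents M X))
      in if \<Gamma> = [] then c
         else (c \<otimes>\<^bsub>C\<^esub> Ident C (tensor_vars C M \<Gamma>)) \<cdot>\<^bsub>C\<^esub> Copy C (tensor_vars C M \<Gamma>))"

fun run ::
  "('o, 'm, 'z) markov_data_scheme \<Rightarrow> ('v::linorder, 'o, 'm, 'y) causal_model_scheme \<Rightarrow>
   'v list \<Rightarrow> 'v list \<Rightarrow> 'v list \<Rightarrow> 'm" where
  "run C M \<Gamma> [] \<Delta> = wire C M \<Gamma> \<Delta>"
| "run C M \<Gamma> (X # Xs) \<Delta> = run C M (X # \<Gamma>) Xs \<Delta> \<cdot>\<^bsub>C\<^esub> apply_mech C M \<Gamma> X"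

definition relevant :: "('v, 'o, 'm, 'y) causal_model_scheme \<Rightarrow> 'v set" where
  "relevant M = {X \<in> noninputs M. \<exists>Y \<in> outputs M. (X, Y) \<in> (edges M)\<^sup>*}"

text \<open>In a finite acyclic graph the number of proper ancestors increases strictly along edges, so
  sorting by it gives a topological order. The channel \<open>io\<close> does not depend on which topological
  order is taken.\<close>

definition topological_order ::
  "('v::linorder, 'o, 'm, 'y) causal_model_scheme \<Rightarrow> 'v set \<Rightarrow> 'v list" where
  "topological_order M S = sort_key (\<lambda>X. card {Y. (Y, X) \<in> (edges M)\<^sup>+}) (sorted_list_of_set S)"

definition io ::
  "('o, 'm, 'z) markov_data_scheme \<Rightarrow> ('v::linorder, 'o, 'm, 'y) causal_model_scheme \<Rightarrow> 'm" where
  "io C M = run C M (sorted_list_of_set (inputs M)) (topological_order M (relevant M))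
              (sorted_list_of_set (outputs M))"


section \<open>Exact transformations\<close>

definition exact_transformation ::
  "('o, 'm, 'z) markov_data_scheme \<Rightarrow>
   ('v::linorder, 'o, 'm) causal_model \<Rightarrow> ('w::linorder, 'o, 'm) causal_model \<Rightarrow>
   ('v, 'm) intervention set \<Rightarrow> ('w, 'm) intervention set \<Rightarrow>
   'm \<Rightarrow> 'm \<Rightarrow> (('v, 'm) intervention \<rightharpoonup> ('w, 'm) intervention) \<Rightarrow> bool" where
  "exact_transformation C L H \<I>L \<I>H \<tau>in \<tau>out \<omega> \<longleftrightarrow>
     \<tau>in \<in> Hom C (set_object C L (inputs L)) (set_object C H (inputs H)) \<and>
     epic C \<tau>in \<and> deterministic C \<tau>in \<and>
     \<tau>out \<in> Hom C (set_object C L (outputs L)) (set_object C H (outputs H)) \<and>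
     epic C \<tau>out \<and> deterministic C \<tau>out \<and>
     dom \<omega> \<subseteq> \<I>L \<and> ran \<omega> = \<I>H \<and>
     (\<forall>\<sigma> \<sigma>'. \<omega> \<sigma> = Some \<sigma>' \<longrightarrow>
        \<tau>out \<cdot>\<^bsub>C\<^esub> io C (intervene L \<sigma>) = io C (intervene H \<sigma>') \<cdot>\<^bsub>C\<^esub> \<tau>in)"


section \<open>Query signatures and upward abstractions\<close>

record ('t, 'q) query_signature =
  types :: "'t set"
  queries :: "'q set"
  query_ins :: "'q \<Rightarrow> 't list"
  query_outs :: "'q \<Rightarrow> 't list"

record ('t, 'q, 'o, 'm) query_model =
  type_object :: "'t \<Rightarrow> 'o"
  query_channel :: "'q \<Rightarrow> 'm"

definition is_query_signature :: "('t, 'q) query_signature \<Rightarrow> bool" where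
  "is_query_signature Q \<longleftrightarrow>
     (\<forall>q \<in> queries Q. query_ins Q q \<in> lists (types Q) \<and> query_outs Q q \<in> lists (types Q))"

definition types_object ::
  "('o, 'm, 'z) markov_data_scheme \<Rightarrow> ('t, 'q, 'o, 'm) query_model \<Rightarrow> 't list \<Rightarrow> 'o" where
  "types_object C N Xs = Tensor_list C (map (type_object N) Xs)"

definition is_query_model ::
  "('o, 'm, 'z) markov_data_scheme \<Rightarrow> ('t, 'q) query_signature \<Rightarrow> ('t, 'q, 'o, 'm) query_model \<Rightarrow> bool"
where
  "is_query_model C Q N \<longleftrightarrow>
     (\<forall>X \<in> types Q. type_object N X \<in> Obj C) \<and>
     (\<forall>q \<in> queries Q. query_channel N q \<in>
        Hom C (types_object C N (query_ins Q q)) (types_object C N (query_outs Q q)))"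

text \<open>The extension of \<open>\<pi>\<close> to lists is \<open>concat (map \<pi> Xs)\<close>; that of \<open>\<tau>\<close> is the tensor product,
  precomposed with the coherence isomorphism for the concatenation.\<close>

fun tau_list ::
  "('o, 'm, 'z) markov_data_scheme \<Rightarrow> ('s, 'p, 'o, 'm) query_model \<Rightarrow>
   ('t \<Rightarrow> 's list) \<Rightarrow> ('t \<Rightarrow> 'm) \<Rightarrow> 't list \<Rightarrow> 'm" where
  "tau_list C N \<pi> \<tau> [] = Ident C (Unit_obj C)"
| "tau_list C N \<pi> \<tau> [X] = \<tau> X"
| "tau_list C N \<pi> \<tau> (X # Y # Xs) =
     (\<tau> X \<otimes>\<^bsub>C\<^esub> tau_list C N \<pi> \<tau> (Y # Xs))
     \<cdot>\<^bsub>C\<^esub> Split_list C (map (type_object N) (\<pi> X))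
                    (map (type_object N) (concat (map \<pi> (Y # Xs))))"

text \<open>The set \<open>\<X>\<close> collects the lists of high-level types for which the product \<open>\<tau>\<^sub>X\<close> is required to
  be epic, in addition to the \<open>\<tau>\<^sub>X\<close> for single types.\<close>

definition upward_abstraction_wrt ::
  "'t list set \<Rightarrow> ('o, 'm, 'z) markov_data_scheme \<Rightarrow>
   ('s, 'p) query_signature \<Rightarrow> ('s, 'p, 'o, 'm) query_model \<Rightarrow>
   ('t, 'q) query_signature \<Rightarrow> ('t, 'q, 'o, 'm) query_model \<Rightarrow>
   ('t \<Rightarrow> 's list) \<Rightarrow> ('t \<Rightarrow> 'm) \<Rightarrow> ('p \<rightharpoonup> 'q) \<Rightarrow> bool" where
  "upward_abstraction_wrt \<X> C QL NL QH NH \<pi> \<tau> \<omega> \<longleftrightarrow>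
     is_query_signature QL \<and> is_query_model C QL NL \<and>
     is_query_signature QH \<and> is_query_model C QH NH \<and>
     (\<forall>X \<in> types QH. \<pi> X \<in> lists (types QL) \<and>
        \<tau> X \<in> Hom C (types_object C NL (\<pi> X)) (type_object NH X) \<and>
        epic C (\<tau> X) \<and> deterministic C (\<tau> X)) \<and>
     (\<forall>Xs \<in> \<X>. epic C (tau_list C NL \<pi> \<tau> Xs)) \<and>
     dom \<omega> \<subseteq> queries QL \<and> ran \<omega> = queries QH \<and>
     (\<forall>qL qH. \<omega> qL = Some qH \<longrightarrow>
        query_ins QL qL = concat (map \<pi> (query_ins QH qH)) \<and>
        query_outs QL qL = concat (map \<pi> (query_outs QH qH)) \<and>
        tau_list C NL \<pi> \<tau> (query_outs QH qH) \<cdot>\<^bsub>C\<^esub> query_channel NL qL =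
        query_channel NH qH \<cdot>\<^bsub>C\<^esub> tau_list C NL \<pi> \<tau> (query_ins QH qH))"

text \<open>The products required to be epic are those that occur in the equations, that is, the products
  over the input and output lists of the high-level queries.\<close>

definition upward_abstraction ::
  "('o, 'm, 'z) markov_data_scheme \<Rightarrow>
   ('s, 'p) query_signature \<Rightarrow> ('s, 'p, 'o, 'm) query_model \<Rightarrow>
   ('t, 'q) query_signature \<Rightarrow> ('t, 'q, 'o, 'm) query_model \<Rightarrow>
   ('t \<Rightarrow> 's list) \<Rightarrow> ('t \<Rightarrow> 'm) \<Rightarrow> ('p \<rightharpoonup> 'q) \<Rightarrow> bool" where
  "upward_abstraction C QL NL QH NH =
     upward_abstraction_wrt (query_ins QH ` queries QH \<union> query_outs QH ` queries QH) C QL NL QH NH"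

text \<open>The strict variant requires it for the products over all finite lists of high-level types,
  whether or not a query uses them. In a general Markov category this does not follow from the
  \<open>\<tau>\<^sub>X\<close> for single types being epic. For instance, in the opposite of the category of commutative
  rings (a cartesian category, in which every morphism is deterministic), take the inclusion of the
  square-zero extension of the integers by \<open>\<int>/2\<close> into the one by the quasi-cyclic group
  \<open>\<int>[1/2]/\<int>\<close>: it is injective, but its tensor square is not.\<close>

definition strict_upward_abstraction ::
  "('o, 'm, 'z) markov_data_scheme \<Rightarrow>
   ('s, 'p) query_signature \<Rightarrow> ('s, 'p, 'o, 'm) query_model \<Rightarrow>
   ('t, 'q) query_signature \<Rightarrow> ('t, 'q, 'o, 'm) query_model \<Rightarrow>
   ('t \<Rightarrow> 's list) \<Rightarrow> ('t \<Rightarrow> 'm) \<Rightarrow> ('p \<rightharpoonup> 'q) \<Rightarrow> bool" where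
  "strict_upward_abstraction C QL NL QH NH =
     upward_abstraction_wrt (lists (types QH)) C QL NL QH NH"


section \<open>The query signature of a set of interventions\<close>

datatype io_type = In | Out

definition io_signature :: "('v, 'm) intervention set \<Rightarrow> (io_type, ('v, 'm) intervention) query_signature"
where
  "io_signature \<I> =
     \<lparr> types = {In, Out}, queries = \<I>, query_ins = (\<lambda>_. [In]), query_outs = (\<lambda>_. [Out]) \<rparr>"

definition io_model ::
  "('o, 'm, 'z) markov_data_scheme \<Rightarrow> ('v::linorder, 'o, 'm) causal_model \<Rightarrow>
   (io_type, ('v, 'm) intervention, 'o, 'm) query_model" where
  "io_model C M =
     \<lparr> type_object = (\<lambda>X. case X of In \<Rightarrow> set_object C M (inputs M) | Out \<Rightarrow> set_object C M (outputs M)),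
       query_channel = (\<lambda>\<sigma>. io C (intervene M \<sigma>)) \<rparr>"

text \<open>The assignment \<open>\<pi>\<close> of low-level to high-level types, and the channels \<open>\<tau>\<close> given by a pair of
  channels between the inputs and between the outputs. The same two names \<open>In\<close> and \<open>Out\<close> are used
  for the types of either signature.\<close>

definition io_pi :: "io_type \<Rightarrow> io_type list" where
  "io_pi = (\<lambda>X. case X of In \<Rightarrow> [In] | Out \<Rightarrow> [Out])"

definition io_tau :: "'m \<Rightarrow> 'm \<Rightarrow> io_type \<Rightarrow> 'm" where
  "io_tau \<tau>in \<tau>out = (\<lambda>X. case X of In \<Rightarrow> \<tau>in | Out \<Rightarrow> \<tau>out)"

end

theory Submission
  imports Defs
begin

text \<open>Since the input and output lists of the queries are singletons, the tensor products of the
  components of the abstraction are trivial and its conditions are literally those of an exact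
  transformation, except that an abstraction presupposes a model of the query signature. So the
  content lies in showing that \<open>io\<close> of an intervened model is a channel from its inputs to its
  outputs. This holds since the relevant variables are closed under non-input parents and are
  evaluated in an order in which parents come first.\<close>

section \<open>Causal models under interventions\<close>

lemma causal_model_parents_subset:
  assumes "is_causal_model C M"
  shows "parents M X \<subseteq> verts M"
  using assms by (auto simp: is_causal_model_def open_dag_def parents_def)

lemma intervene_simps [simp]:
  "verts (intervene M \<sigma>) = verts M"
  "inputs (intervene M \<sigma>) = inputs M"
  "outputs (intervene M \<sigma>) = outputs M"
  "object (intervene M \<sigma>) = object M"
  "noninputs (intervene M \<sigma>) = noninputs M"
  "tensor_vars C (intervene M \<sigma>) Xs = tensor_vars C M Xs"
  "set_object C (intervene M \<sigma>) S = set_object C M S"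
  by (simp_all add: intervene_def noninputs_def tensor_vars_def set_object_def)

lemma parents_intervene:
  "parents (intervene M \<sigma>) X = (case \<sigma> X of None \<Rightarrow> parents M X | Some (P, c) \<Rightarrow> P)"
  by (auto simp: parents_def intervene_def split: option.splits)

lemma mech_intervene:
  "mech (intervene M \<sigma>) X = (case \<sigma> X of None \<Rightarrow> mech M X | Some (P, c) \<Rightarrow> c)"
  by (simp add: intervene_def)

text \<open>This lets the typing of \<open>io\<close>, proved for arbitrary causal models, be
  applied to every intervened model.\<close>

lemma is_causal_model_intervene:
  assumes M: "is_causal_model C M" and \<sigma>: "is_intervention C M \<sigma>"
  shows "is_causal_model C (intervene M \<sigma>)"
proof -
  \<comment> \<open>Only non-inputs are acted on. Hence new edges end in \<open>verts M\<close> and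
    inputs remain parentless.\<close>
  have dom: "\<sigma> X = None \<or> X \<in> noninputs M" for X
    using \<sigma> by (cases "\<sigma> X") (auto simp: is_intervention_def)
  have some: "P \<subseteq> verts M" "c \<in> Hom C (set_object C M P) (object M X)"
    if "\<sigma> X = Some (P, c)" for X P c
    using \<sigma> that by (auto simp: is_intervention_def)
  have "edges (intervene M \<sigma>) \<subseteq> verts M \<times> verts M"
  proof
    fix e assume e: "e \<in> edges (intervene M \<sigma>)"
    obtain Y X where YX: "e = (Y, X)" by force
    show "e \<in> verts M \<times> verts M"
    proof (cases "\<sigma> X")
      case None
      then show ?thesis
        using e YX M by (auto simp: intervene_def is_causal_model_def open_dag_def)
    next
      case (Some Pc)
      obtain P c where Pc: "Pc = (P, c)" by force
      have "Y \<in> P" using e YX Some Pc by (simp add: intervene_def)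
      moreover have "X \<in> verts M" using dom[of X] Some by (auto simp: noninputs_def)
      ultimately show ?thesis using some(1)[of X P c] Some Pc YX by auto
    qed
  qed
  moreover have "parents (intervene M \<sigma>) X = {}" if "X \<in> inputs M" for X
    using dom[of X] that M
    by (auto simp: parents_intervene noninputs_def is_causal_model_def open_dag_def)
  moreover have "mech (intervene M \<sigma>) X \<in> Hom C (set_object C M (parents (intervene M \<sigma>) X)) (object M X)"
    if "X \<in> noninputs M" for X
    using that M some(2)[of X]
    by (cases "\<sigma> X") (auto simp: mech_intervene parents_intervene is_causal_model_def)
  moreover have "acyclic (edges (intervene M \<sigma>))"
    using \<sigma> by (simp add: is_intervention_def)
  ultimately show ?thesis
    using M by (simp add: is_causal_model_def open_dag_def)
qed

section \<open>Topological order and relevant variables\<close>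

text \<open>From \<open>x\<close> onwards all keys are at least \<open>f x\<close>, so a strictly
  smaller key can only occur in the prefix.\<close>

lemma sort_key_smaller_before:
  assumes "sort_key f xs = as @ x # bs" and "y \<in> set xs" and "f y < f x"
  shows "y \<in> set as"
proof -
  have "sorted (map f (as @ x # bs))"
    using sorted_sort_key[of f xs] assms(1) by simp
  then have "\<forall>z \<in> set (x # bs). f x \<le> f z"
    by (auto simp: sorted_append)
  moreover have "y \<in> set (as @ x # bs)"
    using assms(1,2) by (metis set_sort)
  ultimately show ?thesis
    using assms(3) by fastforce
qed

text \<open>Transitivity makes ancestors of \<open>y\<close> ancestors of \<open>x\<close>;
  finiteness turns the strict inclusion into a strict inequality of cardinalities.\<close>

lemma card_ancestors_less:
  assumes "finite r" and "acyclic r" and "(y, x) \<in> r"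
  shows "card {z. (z, y) \<in> r\<^sup>+} < card {z. (z, x) \<in> r\<^sup>+}"
proof (rule psubset_card_mono)
  have "{z. (z, x) \<in> r\<^sup>+} \<subseteq> Domain r"
    by (auto dest: tranclD)
  then show "finite {z. (z, x) \<in> r\<^sup>+}"
    using assms(1) finite_Domain finite_subset by blast
  \<comment> \<open>The witness of strictness is \<open>y\<close>: an ancestor of \<open>x\<close>,
    but by acyclicity not of itself.\<close>
  have "(y, y) \<notin> r\<^sup>+" using assms(2) by (simp add: acyclic_def)
  then show "{z. (z, y) \<in> r\<^sup>+} \<subset> {z. (z, x) \<in> r\<^sup>+}"
    using assms(3) by (auto intro: trancl_into_trancl)
qed

lemma set_topological_order:
  "finite S \<Longrightarrow> set (topological_order M S) = S"
  by (simp add: topological_order_def)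

lemma topological_order_parents_before:
  assumes M: "open_dag M" and S: "S \<subseteq> verts M"
    and order: "topological_order M S = As @ X # Bs" and Y: "Y \<in> parents M X" "Y \<in> S"
  shows "Y \<in> set As"
proof (rule sort_key_smaller_before)
  show "sort_key (\<lambda>X. card {Y. (Y, X) \<in> (edges M)\<^sup>+}) (sorted_list_of_set S) = As @ X # Bs"
    using order by (simp add: topological_order_def)
  have fin: "finite (verts M)" using M by (simp add: open_dag_def)
  then show "Y \<in> set (sorted_list_of_set S)"
    using Y(2) S finite_subset by fastforce
  have "finite (edges M)"
    using M fin finite_subset[of "edges M" "verts M \<times> verts M"] by (simp add: open_dag_def)
  then show "card {Z. (Z, Y) \<in> (edges M)\<^sup>+} < card {Z. (Z, X) \<in> (edges M)\<^sup>+}"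
    using M Y(1) by (intro card_ancestors_less) (auto simp: open_dag_def parents_def)
qed

text \<open>Prefixing the edge from the parent extends a path to an output, so a parent that is not
  an input is again relevant.\<close>

lemma relevant_parents:
  assumes "is_causal_model C M" and "X \<in> relevant M"
  shows "parents M X \<subseteq> inputs M \<union> relevant M"
proof
  fix Y assume Y: "Y \<in> parents M X"
  then have "(Y, X) \<in> edges M" by (simp add: parents_def)
  moreover have "Y \<in> verts M"
    using Y causal_model_parents_subset[OF assms(1)] by blast
  ultimately show "Y \<in> inputs M \<union> relevant M"
    using assms(2) by (auto simp: relevant_def noninputs_def intro: converse_rtrancl_into_rtrancl)
qed

text \<open>A non-input output is relevant through the path of length zero.\<close>

lemma outputs_subset_inputs_relevant:
  assumes "is_causal_model C M"
  shows "outputs M \<subseteq> inputs M \<union> relevant M"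
  using assms by (auto simp: is_causal_model_def relevant_def noninputs_def)

section \<open>Typing of the evaluated string diagram\<close>

context monoidal_category
begin

lemma Tensor_list_obj: "set As \<subseteq> Obj C \<Longrightarrow> Tensor_list C As \<in> Obj C"
  by (induction As rule: induct_list012) (auto simp: unit_obj tensor_obj)

lemma tensor_vars_obj:
  assumes "is_causal_model C M" and "set Xs \<subseteq> verts M"
  shows "tensor_vars C M Xs \<in> Obj C"
  unfolding tensor_vars_def
  using assms by (intro Tensor_list_obj) (auto simp: is_causal_model_def)

lemma set_object_obj:
  assumes M: "is_causal_model C M" and S: "S \<subseteq> verts M"
  shows "set_object C M S \<in> Obj C"
proof -
  have "finite S"
    using M S finite_subset by (auto simp: is_causal_model_def open_dag_def)
  then show ?thesis
    unfolding set_object_def using S by (intro tensor_vars_obj[OF M]) simp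
qed

end

context markov_category
begin

text \<open>Membership of \<open>X\<close> in the context keeps the recursion away from the
  \<open>undefined\<close> clauses. One-element lists form a separate case because
  \<open>Tensor_list\<close> puts no unit behind the last object.\<close>

lemma lookup_hom:
  assumes M: "is_causal_model C M"
  shows "set \<Gamma> \<subseteq> verts M \<Longrightarrow> X \<in> set \<Gamma> \<Longrightarrow>
    lookup C M \<Gamma> X \<in> Hom C (tensor_vars C M \<Gamma>) (object M X)"
proof (induction \<Gamma> rule: induct_list012)
  case (2 Y)
  then show ?case
    using M by (auto simp: tensor_vars_def is_causal_model_def intro: ident_hom)
next
  case (3 Y Z \<Gamma>)
  have obj: "object M V \<in> Obj C" if "V \<in> verts M" for V
    using M that by (simp add: is_causal_model_def)
  have dom: "tensor_vars C M (Y # Z # \<Gamma>) = object M Y \<odot> tensor_vars C M (Z # \<Gamma>)"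
    by (simp add: tensor_vars_def)
  have T: "tensor_vars C M (Z # \<Gamma>) \<in> Obj C"
    using 3 by (intro tensor_vars_obj[OF M]) auto
  show ?case
  proof (cases "X = Y")
    case True
    have "Ident C (object M Y) \<otimes> Discard C (tensor_vars C M (Z # \<Gamma>))
        \<in> Hom C (object M Y \<odot> tensor_vars C M (Z # \<Gamma>)) (object M Y \<odot> Unit_obj C)"
      using 3 T obj by (intro tensor_hom ident_hom discard_hom) auto
    then show ?thesis
      using True 3 obj unfolding dom by (auto intro: comp_hom runit_hom)
  next
    case False
    then have "lookup C M (Z # \<Gamma>) X \<in> Hom C (tensor_vars C M (Z # \<Gamma>)) (object M X)"
      using 3 by simp
    then have "Discard C (object M Y) \<otimes> lookup C M (Z # \<Gamma>) X
        \<in> Hom C (object M Y \<odot> tensor_vars C M (Z # \<Gamma>)) (Unit_obj C \<odot> object M X)"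
      using 3 obj by (intro tensor_hom discard_hom) auto
    moreover have "Lunit C (object M X) \<in> Hom C (Unit_obj C \<odot> object M X) (object M X)"
      using 3 obj by (intro lunit_hom) auto
    ultimately show ?thesis
      using False unfolding dom by (auto intro: comp_hom)
  qed
qed simp

lemma wire_hom:
  assumes M: "is_causal_model C M" and \<Gamma>: "set \<Gamma> \<subseteq> verts M"
  shows "set \<Delta> \<subseteq> set \<Gamma> \<Longrightarrow> wire C M \<Gamma> \<Delta> \<in> Hom C (tensor_vars C M \<Gamma>) (tensor_vars C M \<Delta>)"
proof (induction \<Delta> rule: induct_list012)
  case 1
  then show ?case
    using discard_hom[OF tensor_vars_obj[OF M \<Gamma>]] by (simp add: tensor_vars_def)
next
  case (2 X)
  then show ?case
    using lookup_hom[OF M \<Gamma>, of X] by (simp add: tensor_vars_def)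
next
  case (3 X Y \<Delta>)
  have "lookup C M \<Gamma> X \<otimes> wire C M \<Gamma> (Y # \<Delta>)
      \<in> Hom C (tensor_vars C M \<Gamma> \<odot> tensor_vars C M \<Gamma>) (object M X \<odot> tensor_vars C M (Y # \<Delta>))"
    using 3 by (intro tensor_hom lookup_hom[OF M \<Gamma>]) auto
  then show ?case
    using comp_hom[OF copy_hom[OF tensor_vars_obj[OF M \<Gamma>]]] by (simp add: tensor_vars_def)
qed

lemma apply_mech_hom:
  assumes M: "is_causal_model C M" and \<Gamma>: "set \<Gamma> \<subseteq> verts M"
    and X: "X \<in> noninputs M" "parents M X \<subseteq> set \<Gamma>"
  shows "apply_mech C M \<Gamma> X \<in> Hom C (tensor_vars C M \<Gamma>) (tensor_vars C M (X # \<Gamma>))"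
proof -
  let ?T = "tensor_vars C M \<Gamma>"
  define c where "c = mech M X \<cdot> wire C M \<Gamma> (sorted_list_of_set (parents M X))"
  \<comment> \<open>Finiteness makes \<open>sorted_list_of_set\<close> enumerate the parents; on an
    infinite set it returns the empty list.\<close>
  have "finite (parents M X)"
    using X(2) finite_subset by blast
  then have "wire C M \<Gamma> (sorted_list_of_set (parents M X)) \<in> Hom C ?T (set_object C M (parents M X))"
    unfolding set_object_def using X(2) by (intro wire_hom[OF M \<Gamma>]) simp
  moreover have "mech M X \<in> Hom C (set_object C M (parents M X)) (object M X)"
    using M X(1) by (simp add: is_causal_model_def)
  ultimately have c: "c \<in> Hom C ?T (object M X)"
    unfolding c_def by (rule comp_hom)
  show ?thesis
  \<comment> \<open>With an empty context the new context \<open>[X]\<close> has the object of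
    \<open>X\<close> itself as product, so there is no second factor to carry along.\<close>
  proof (cases \<Gamma>)
    case Nil
    then show ?thesis
      using c by (simp add: apply_mech_def c_def tensor_vars_def)
  next
    case (Cons Y \<Gamma>')
    have T: "?T \<in> Obj C" by (rule tensor_vars_obj[OF M \<Gamma>])
    have "(c \<otimes> Ident C ?T) \<cdot> Copy C ?T \<in> Hom C ?T (object M X \<odot> ?T)"
      by (rule comp_hom[OF copy_hom[OF T] tensor_hom[OF c ident_hom[OF T]]])
    moreover have "tensor_vars C M (X # \<Gamma>) = object M X \<odot> ?T"
      using Cons by (simp add: tensor_vars_def)
    ultimately show ?thesis
      using Cons by (simp add: apply_mech_def c_def)
  qed
qed

text \<open>The condition on splittings of \<open>Xs\<close> says that when the turn of
  \<open>X\<close> comes, its parents are already in the context. The context is generalised because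
  each step enlarges it.\<close>

lemma run_hom:
  assumes M: "is_causal_model C M"
  shows "set \<Gamma> \<subseteq> verts M \<Longrightarrow> set Xs \<subseteq> noninputs M \<Longrightarrow>
    (\<And>As X Bs. Xs = As @ X # Bs \<Longrightarrow> parents M X \<subseteq> set \<Gamma> \<union> set As) \<Longrightarrow>
    set \<Delta> \<subseteq> set \<Gamma> \<union> set Xs \<Longrightarrow>
    run C M \<Gamma> Xs \<Delta> \<in> Hom C (tensor_vars C M \<Gamma>) (tensor_vars C M \<Delta>)"
proof (induction Xs arbitrary: \<Gamma>)
  case Nil
  then show ?case using wire_hom[OF M] by simp
next
  case (Cons X Xs)
  \<comment> \<open>The empty prefix in the splitting condition shows that all parents of the head
    lie in \<open>\<Gamma>\<close>.\<close>
  have "apply_mech C M \<Gamma> X \<in> Hom C (tensor_vars C M \<Gamma>) (tensor_vars C M (X # \<Gamma>))"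
    using Cons.prems(1,2) Cons.prems(3)[of "[]"] by (intro apply_mech_hom[OF M]) auto
  moreover have "run C M (X # \<Gamma>) Xs \<Delta> \<in> Hom C (tensor_vars C M (X # \<Gamma>)) (tensor_vars C M \<Delta>)"
  proof (rule Cons.IH)
    show "set (X # \<Gamma>) \<subseteq> verts M"
      using Cons.prems(1,2) by (auto simp: noninputs_def)
    \<comment> \<open>As \<open>X\<close> has moved into the context, a prefix \<open>As\<close> of
      the tail corresponds to the prefix \<open>X # As\<close> of the whole list.\<close>
    show "parents M Z \<subseteq> set (X # \<Gamma>) \<union> set As" if "Xs = As @ Z # Bs" for As Z Bs
      using Cons.prems(3)[of "X # As" Z Bs] that by auto
  qed (use Cons.prems in auto)
  ultimately show ?case
    by (simp add: comp_hom)
qed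

lemma io_hom:
  assumes M: "is_causal_model C M"
  shows "io C M \<in> Hom C (set_object C M (inputs M)) (set_object C M (outputs M))"
  unfolding io_def set_object_def
proof (rule run_hom[OF M])
  have dag: "open_dag M" and fin: "finite (verts M)"
    and sub: "inputs M \<subseteq> verts M" "outputs M \<subseteq> verts M" "relevant M \<subseteq> verts M"
    using M by (auto simp: is_causal_model_def open_dag_def relevant_def noninputs_def)
  have sets: "set (sorted_list_of_set (inputs M)) = inputs M"
    "set (sorted_list_of_set (outputs M)) = outputs M"
    "set (topological_order M (relevant M)) = relevant M"
    using fin sub by (auto simp: finite_subset set_topological_order)
  show "set (sorted_list_of_set (inputs M)) \<subseteq> verts M"
    using sub sets by simp
  show "set (topological_order M (relevant M)) \<subseteq> noninputs M"
    unfolding sets by (auto simp: relevant_def)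
  show "set (sorted_list_of_set (outputs M))
      \<subseteq> set (sorted_list_of_set (inputs M)) \<union> set (topological_order M (relevant M))"
    unfolding sets by (rule outputs_subset_inputs_relevant[OF M])
  fix As X Bs assume order: "topological_order M (relevant M) = As @ X # Bs"
  then have "X \<in> relevant M"
    using sets(3) by auto
  \<comment> \<open>Each parent is an input, present from the start, or relevant, hence evaluated
    within \<open>As\<close>.\<close>
  then show "parents M X \<subseteq> set (sorted_list_of_set (inputs M)) \<union> set As"
    unfolding sets
    using relevant_parents[OF M] topological_order_parents_before[OF dag sub(3) order] by blast
qed

section \<open>Query models of interventions and the equivalence\<close>

lemma is_query_model_io_model:
  assumes M: "is_causal_model C M" and \<I>: "\<forall>\<sigma> \<in> \<I>. is_intervention C M \<sigma>"
  shows "is_query_model C (io_signature \<I>) (io_model C M)"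
proof -
  have "inputs M \<subseteq> verts M" "outputs M \<subseteq> verts M"
    using M by (auto simp: is_causal_model_def open_dag_def)
  then have "set_object C M (inputs M) \<in> Obj C" "set_object C M (outputs M) \<in> Obj C"
    by (auto intro: set_object_obj[OF M])
  \<comment> \<open>Interventions change neither inputs, outputs nor objects, so all queries share
    the same two objects.\<close>
  moreover have "io C (intervene M \<sigma>)
      \<in> Hom C (set_object C M (inputs M)) (set_object C M (outputs M))" if "\<sigma> \<in> \<I>" for \<sigma>
    using io_hom[OF is_causal_model_intervene[OF M]] \<I> that by simp
  ultimately show ?thesis
    by (simp add: is_query_model_def io_signature_def io_model_def types_object_def)
qed

end

lemma is_query_signature_io_signature: "is_query_signature (io_signature \<I>)"
  by (simp add: is_query_signature_def io_signature_def)

text \<open>With \<open>\<X>\<close> arbitrary, one comparison serves both the plain and the strict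
  notion; they differ only in the products required to be epic.\<close>

lemma upward_abstraction_wrt_io_iff:
  assumes "is_query_model C (io_signature \<I>L) (io_model C L)"
    and "is_query_model C (io_signature \<I>H) (io_model C H)"
  shows "upward_abstraction_wrt \<X> C (io_signature \<I>L) (io_model C L) (io_signature \<I>H) (io_model C H)
      io_pi (io_tau \<tau>in \<tau>out) \<omega> \<longleftrightarrow>
    exact_transformation C L H \<I>L \<I>H \<tau>in \<tau>out \<omega> \<and>
    (\<forall>Xs \<in> \<X>. epic C (tau_list C (io_model C L) io_pi (io_tau \<tau>in \<tau>out) Xs))"
  using assms
  unfolding upward_abstraction_wrt_def exact_transformation_def
  \<comment> \<open>On singletons \<open>Tensor_list\<close> and \<open>tau_list\<close> return the
    entry itself, so no coherence map appears; the quantifier over types splits into the conditions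
    for \<open>In\<close> and \<open>Out\<close>.\<close>
  by (simp only: is_query_signature_io_signature)
    (auto simp: io_signature_def io_model_def io_pi_def io_tau_def types_object_def)

theorem proposition22:
  fixes C :: "('o, 'm) markov_data"
    and L :: "('v::linorder, 'o, 'm) causal_model"
    and H :: "('w::linorder, 'o, 'm) causal_model"
    and \<I>L :: "('v, 'm) intervention set"
    and \<I>H :: "('w, 'm) intervention set"
    and \<tau>in \<tau>out :: 'm
    and \<omega> :: "('v, 'm) intervention \<rightharpoonup> ('w, 'm) intervention"
  assumes "markov_category C"
    and "is_causal_model C L" and "is_causal_model C H"
    and "\<forall>\<sigma> \<in> \<I>L. is_intervention C L \<sigma>" and "\<forall>\<sigma> \<in> \<I>H. is_intervention C H \<sigma>"
  shows "(exact_transformation C L H \<I>L \<I>H \<tau>in \<tau>out \<omega> \<longleftrightarrow>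
            upward_abstraction C (io_signature \<I>L) (io_model C L) (io_signature \<I>H) (io_model C H)
              io_pi (io_tau \<tau>in \<tau>out) \<omega>) \<and>
         (exact_transformation C L H \<I>L \<I>H \<tau>in \<tau>out \<omega> \<and>
            (\<forall>Xs \<in> lists {In, Out}.
               epic C (tau_list C (io_model C L) io_pi (io_tau \<tau>in \<tau>out) Xs)) \<longleftrightarrow>
            strict_upward_abstraction C (io_signature \<I>L) (io_model C L) (io_signature \<I>H) (io_model C H)
              io_pi (io_tau \<tau>in \<tau>out) \<omega>)"
proof -
  interpret markov_category C by (rule assms(1))
  note wrt_iff = upward_abstraction_wrt_io_iff[OF
      is_query_model_io_model[OF assms(2,4)] is_query_model_io_model[OF assms(3,5)]]
  \<comment> \<open>For the plain notion, the lists in question are at most \<open>[In]\<close> and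
    \<open>[Out]\<close>, whose products are \<open>\<tau>in\<close> and \<open>\<tau>out\<close>,
    epic by the exact transformation.\<close>
  have "epic C (tau_list C (io_model C L) io_pi (io_tau \<tau>in \<tau>out) Xs)"
    if "exact_transformation C L H \<I>L \<I>H \<tau>in \<tau>out \<omega>" and "Xs \<in> {[In], [Out]}" for Xs
    using that by (auto simp: exact_transformation_def io_tau_def)
  then show ?thesis
    unfolding upward_abstraction_def strict_upward_abstraction_def wrt_iff
    by (auto simp: io_signature_def)
qed

end
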